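(* Let $q$ be any prime and let $M(q)$, $M^c(q)$ and $d(q)$ be as defined in the context. Then the limit $d(q)$ exists and \[ d(q) = 1 - \left( 1- \frac{1}{q}\right) \prod_{p \neq q,\ p \text{ prime}} \left[1 - \left( 1-\frac{1}{p} \right )\sum_{m \in M(q)} \frac{1}{p^m} \right]. \] Moreover, \[ d(q) = 1 - \left( 1- \frac{1}{q}\right) \prod_{p \neq q,\ p \text{ prime}} \left[\left( 1-\frac{1}{p} \right )\sum_{m \in M^c (q)} \frac{1}{p^m} \right] = 1 - \left(\sum_{m \in M^c (q)} q^{-m}\right)^{-1} \prod_{p \text{ prime}} \left[\left( 1-\frac{1}{p} \right )\sum_{m \in M^c (q)} \frac{1}{p^m} \right]. \]
   Context: Tower factorization: the tower factorization of $1$ is $1$; if $n>1$ has prime factorization $n=p_1^{e_1}\cdots p_k^{e_k}$, its tower factorization is $\prod_{i=1}^k p_i^{(f_i)}$ where $f_i$ is the tower factorization of $e_i$ (recursively; it is unique up to reordering). A prime $q$ is said to be contained in the tower factorization of $n$ if $q$ appears as one of the primes at any level of this recursive representation (e.g. $625=5^{(2^2)}$ contains $2$ and $5$; $144 = 2^{(2^2)}\cdot 3^2$ contains $2$ and $3$). For a prime $q$, $M(q)$ is the set of positive integers whose tower factorization contains $q$ (by convention $1\notin M(q)$, and $0 \notin M(q)$). $M^c(q) := \{z \in \{0,1,2,\ldots\} : z \notin M(q)\}$, so $\{0,1\}\subseteq M^c(q)$. The density is $d(q) := \lim_{N\to\infty} |M(q)\cap\{1,\ldots,N\}|/N$. 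*)

theory Defs
  imports "HOL-Analysis.Analysis" "HOL-Computational_Algebra.Primes"
begin

text \<open>
  The list \<open>[(p\<^sub>1, f\<^sub>1), \<dots>, (p\<^sub>k, f\<^sub>k)]\<close> under the constructor stands for the product of
  the \<open>p\<^sub>i\<close> raised to the numbers represented by the \<open>f\<^sub>i\<close>; the empty list represents \<open>1\<close>.
\<close>

datatype tower = Tower "(nat \<times> tower) list"

primrec tower_value :: "tower \<Rightarrow> nat" where
  "tower_value (Tower xs) = prod_list (map (\<lambda>(p, v). p ^ v) (map (map_prod id tower_value) xs))"

primrec tower_primes :: "tower \<Rightarrow> nat set" where
  "tower_primes (Tower xs) = (\<Union>(p, A) \<in> set (map (map_prod id tower_primes) xs). insert p A)"

lemma multiplicity_less_self:
  fixes n p :: nat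
  assumes "p \<in> prime_factors n"
  shows "multiplicity p n < n"
proof -
  have "p ^ multiplicity p n dvd n" and "n > 0" and "p \<ge> 2"
    using assms by (auto simp: multiplicity_dvd in_prime_factors_iff prime_ge_2_nat)
  then have "p ^ multiplicity p n \<le> n" by (simp add: dvd_imp_le)
  moreover have "multiplicity p n < p ^ multiplicity p n"
    using \<open>p \<ge> 2\<close> by (simp add: power_gt_expt)
  ultimately show ?thesis by linarith
qed

text \<open>
  Uniqueness up to reordering is made strict by listing the primes in increasing order. The value
  at \<open>0\<close>, which has no tower factorization, is the junk value \<open>Tower []\<close>.
\<close>

function tower_factorization :: "nat \<Rightarrow> tower" where
  "tower_factorization n =
     Tower (map (\<lambda>p. (p, tower_factorization (multiplicity p n)))
                (sorted_list_of_set (prime_factors n)))"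
  by auto
termination
  by (relation "Wellfounded.measure id") (auto simp: multiplicity_less_self)

declare tower_factorization.simps [simp del]

lemma tower_factorization_1: "tower_factorization 1 = Tower []"
  by (subst tower_factorization.simps) simp

lemma tower_value_tower_factorization:
  "n > 0 \<Longrightarrow> tower_value (tower_factorization n) = n"
proof (induction n rule: less_induct)
  case (less n)
  have "tower_value (tower_factorization n) =
      prod_list (map (\<lambda>p. p ^ tower_value (tower_factorization (multiplicity p n)))
        (sorted_list_of_set (prime_factors n)))"
    by (subst tower_factorization.simps) (simp add: o_def)
  also have "\<dots> = prod_list (map (\<lambda>p. p ^ multiplicity p n)
        (sorted_list_of_set (prime_factors n)))"
  proof (intro arg_cong[where f = prod_list] map_cong refl)
    fix p assume "p \<in> set (sorted_list_of_set (prime_factors n))"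
    then have p: "p \<in> prime_factors n" by simp
    then have "multiplicity p n > 0"
      by (auto simp: prime_factors_multiplicity)
    with less.IH[OF multiplicity_less_self[OF p]]
    show "p ^ tower_value (tower_factorization (multiplicity p n)) = p ^ multiplicity p n"
      by simp
  qed
  also have "\<dots> = (\<Prod>p\<in>prime_factors n. p ^ multiplicity p n)"
    by (subst prod.distinct_set_conv_list[symmetric]) simp_all
  also have "\<dots> = n"
    using less.prems by (simp add: prime_factorization_nat[symmetric])
  finally show ?case .
qed

lemma tower_primes_tower_factorization:
  "tower_primes (tower_factorization n) =
     (\<Union>p\<in>prime_factors n. insert p (tower_primes (tower_factorization (multiplicity p n))))"
  by (subst tower_factorization.simps) auto

definition tower_M :: "nat \<Rightarrow> nat set" where
  "tower_M q = {n. n > 0 \<and> q \<in> tower_primes (tower_factorization n)}"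

definition tower_Mc :: "nat \<Rightarrow> nat set" where
  "tower_Mc q = {z. z \<notin> tower_M q}"

definition tower_M_ratio :: "nat \<Rightarrow> nat \<Rightarrow> real" where
  "tower_M_ratio q N = real (card (tower_M q \<inter> {1..N})) / real N"

definition tower_density :: "nat \<Rightarrow> real" where
  "tower_density q = lim (tower_M_ratio q)"

lemma zero_one_notin_tower_M: "0 \<notin> tower_M q" "1 \<notin> tower_M q"
  by (simp_all add: tower_M_def tower_factorization_1 del: One_nat_def)

end

theory Submission
  imports Defs "HOL-Real_Asymp.Real_Asymp"
begin

text \<open>
  A positive \<open>n\<close> lies outside \<open>M(q)\<close> iff \<open>q\<close> does not divide \<open>n\<close> and every exponent in its prime
  factorization lies in \<open>M\<^sup>c(q)\<close>. Imposing such a condition on the \<open>p\<close>-adic valuation for one prime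
  \<open>p\<close> after the other multiplies the density by one Euler factor each time. Since \<open>0\<close> and \<open>1\<close> are
  always allowed exponents for \<open>p \<noteq> q\<close>, all conditions at primes \<open>p \<ge> k\<close> together only affect
  multiples of squares \<open>p\<^sup>2\<close> with \<open>p \<ge> k\<close>, whose frequency is at most \<open>1 / (k - 1)\<close>. This uniform
  bound allows the limits over the primes and over \<open>N\<close> to be interchanged.
\<close>

section \<open>Natural density and dilation\<close>

definition has_natural_density :: "nat set \<Rightarrow> real \<Rightarrow> bool" where
  "has_natural_density A d \<longleftrightarrow> (\<lambda>N. real (card (A \<inter> {1..N})) / real N) \<longlonglongrightarrow> d"

lemma has_natural_density_UNIV: "has_natural_density UNIV 1"
  unfolding has_natural_density_def
  by (rule tendsto_eventually, rule eventually_mono[OF eventually_gt_at_top[of 0]]) simp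

lemma tendsto_nat_div:
  fixes k :: nat
  shows "(\<lambda>N. real (N div k) / real N) \<longlonglongrightarrow> 1 / real k"
proof (cases "k = 0")
  case False
  show ?thesis
  proof (rule real_tendsto_sandwich)
    show "\<forall>\<^sub>F N in sequentially. 1 / real k - 1 / real N \<le> real (N div k) / real N"
      using eventually_gt_at_top[of 0]
    proof eventually_elim
      case (elim N)
      have "real N < real k * (real (N div k) + 1)"
        using dividend_less_div_times[of k N] False
        by (metis add.commute mult.commute mult_Suc of_nat_Suc of_nat_less_iff of_nat_mult neq0_conv)
      then have "real N / real k < real (N div k) + 1"
        using False by (simp add: field_simps)
      then have "(real N / real k - 1) / real N \<le> real (N div k) / real N"
        using elim by (intro divide_right_mono) auto
      then show ?case using elim by (simp add: diff_divide_distrib)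
    qed
    show "\<forall>\<^sub>F N in sequentially. real (N div k) / real N \<le> 1 / real k"
      using eventually_gt_at_top[of 0]
    proof eventually_elim
      case (elim N)
      have "real (N div k) \<le> real N / real k" by (rule of_nat_div_le_of_nat)
      then have "real (N div k) / real N \<le> real N / real k / real N"
        by (intro divide_right_mono) auto
      then show ?case using elim by simp
    qed
    show "(\<lambda>N. 1 / real k - 1 / real N) \<longlonglongrightarrow> 1 / real k"
      using tendsto_diff[OF tendsto_const lim_1_over_n] by simp
  qed simp
\<comment> \<open>For \<open>k = 0\<close> both sides are \<open>0\<close>, since division by zero
  gives zero.\<close>
qed simp

text \<open>The ratio is the one defining the density of \<open>B\<close>, taken at
  \<open>N div k\<close>, times \<open>(N div k) / N\<close>, which tends to
  \<open>1 / k\<close>.\<close>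

lemma has_natural_density_div:
  assumes "has_natural_density B d" "k > 0"
  shows "(\<lambda>N. real (card (B \<inter> {1..N div k})) / real N) \<longlonglongrightarrow> d / real k"
proof -
  have "filterlim (\<lambda>N. N div k) at_top sequentially"
    using \<open>k > 0\<close> by (intro filterlim_at_top_div_const_nat)
  then have "(\<lambda>N. real (card (B \<inter> {1..N div k})) / real (N div k)) \<longlonglongrightarrow> d"
    using assms(1) unfolding has_natural_density_def by (rule filterlim_compose[rotated])
  from tendsto_mult[OF this tendsto_nat_div[of k]]
  have "(\<lambda>N. real (card (B \<inter> {1..N div k})) / real (N div k) * (real (N div k) / real N))
      \<longlonglongrightarrow> d / real k"
    by simp
  \<comment> \<open>If \<open>N div k = 0\<close> nothing can be cancelled, but then the interval is
    empty and both sides vanish.\<close>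
  moreover have "real (card (B \<inter> {1..N div k})) / real (N div k) * (real (N div k) / real N) =
      real (card (B \<inter> {1..N div k})) / real N" for N
    by (cases "N div k = 0") (auto simp del: div_eq_0_iff of_nat_div)
  ultimately show ?thesis by (simp only:)
qed

section \<open>Counting by p-adic valuation\<close>

lemma mult_power_mem_iff:
  fixes B :: "nat set"
  assumes "\<And>n. n > 0 \<Longrightarrow> p * n \<in> B \<longleftrightarrow> n \<in> B" "p > 0" "n > 0"
  shows "p ^ m * n \<in> B \<longleftrightarrow> n \<in> B"
  using assms by (induction m) (auto simp: mult.assoc)

text \<open>Invariance of \<open>B\<close> under multiplication by \<open>p\<close> makes
  multiplication by \<open>p ^ m\<close> a bijection between the two sets counted.\<close>

lemma card_multiples_power:
  fixes B :: "nat set"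
  assumes inv: "\<And>n. n > 0 \<Longrightarrow> p * n \<in> B \<longleftrightarrow> n \<in> B" and p: "p > 0"
  shows "card {n \<in> B \<inter> {1..N}. p ^ m dvd n} = card (B \<inter> {1..N div p ^ m})"
proof -
  have "{n \<in> B \<inter> {1..N}. p ^ m dvd n} = (*) (p ^ m) ` (B \<inter> {1..N div p ^ m})"
  proof (intro equalityI subsetI)
    fix n assume n: "n \<in> {n \<in> B \<inter> {1..N}. p ^ m dvd n}"
    then obtain k where k: "n = p ^ m * k" by auto
    then have "k > 0" using n by (cases k) auto
    moreover have "k \<in> B" using n k \<open>k > 0\<close> mult_power_mem_iff[OF inv p] by auto
    moreover have "k \<le> N div p ^ m"
      using n k p by (auto simp: less_eq_div_iff_mult_less_eq mult.commute)
    ultimately show "n \<in> (*) (p ^ m) ` (B \<inter> {1..N div p ^ m})" using k by auto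
  next
    fix n assume "n \<in> (*) (p ^ m) ` (B \<inter> {1..N div p ^ m})"
    then obtain k where k: "n = p ^ m * k" "k \<in> B" "k \<ge> 1" "k \<le> N div p ^ m" by fastforce
    then have "n \<in> B" using mult_power_mem_iff[OF inv p] by auto
    then show "n \<in> {n \<in> B \<inter> {1..N}. p ^ m dvd n}"
      using k p by (auto simp: less_eq_div_iff_mult_less_eq mult.commute)
  qed
  moreover have "inj_on ((*) (p ^ m)) (B \<inter> {1..N div p ^ m})"
    using p by (auto simp: inj_on_def)
  ultimately show ?thesis by (simp add: card_image)
qed

text \<open>Valuation exactly \<open>m\<close> means divisible by \<open>p ^ m\<close> but not by
  \<open>p ^ Suc m\<close>, and these two sets of multiples are nested.\<close>

lemma card_multiplicity_eq:
  fixes B :: "nat set"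
  assumes inv: "\<And>n. n > 0 \<Longrightarrow> p * n \<in> B \<longleftrightarrow> n \<in> B" and p: "prime p"
  shows "real (card {n \<in> B \<inter> {1..N}. multiplicity p n = m}) =
    real (card (B \<inter> {1..N div p ^ m})) - real (card (B \<inter> {1..N div p ^ Suc m}))"
proof -
  let ?S = "\<lambda>m. {n \<in> B \<inter> {1..N}. p ^ m dvd n}"
  have "p > 0" using p by (rule prime_gt_0_nat)
  have unit: "\<not> is_unit p" using p by auto
  have "{n \<in> B \<inter> {1..N}. multiplicity p n = m} = ?S m - ?S (Suc m)"
    using unit by (auto simp: power_dvd_iff_le_multiplicity simp del: power_Suc)
  moreover have "?S (Suc m) \<subseteq> ?S m" by (auto dest: dvd_mult_right)
  moreover have "card (?S (Suc m)) \<le> card (?S m)"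
    by (rule card_mono) (use calculation in auto)
  ultimately show ?thesis
    using card_multiples_power[OF inv \<open>p > 0\<close>, of N]
    by (simp add: card_Diff_subset of_nat_diff del: power_Suc)
qed

text \<open>Supplies the domination: after division by \<open>N\<close> the bound is at most
  \<open>1 / p ^ m\<close>, which is independent of \<open>N\<close> and summable over
  \<open>m\<close>.\<close>

lemma card_multiplicity_le:
  "card {n \<in> B \<inter> {1..N}. multiplicity p n = m} \<le> N div p ^ m" if "prime (p::nat)"
proof -
  have "p > 0" using that by (rule prime_gt_0_nat)
  have "card {n \<in> B \<inter> {1..N}. multiplicity p n = m} \<le> card {n \<in> UNIV \<inter> {1..N}. p ^ m dvd n}"
    by (rule card_mono) (auto simp: multiplicity_dvd)
  also have "\<dots> = N div p ^ m"
    using card_multiples_power[of p UNIV N m] \<open>p > 0\<close> by simp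
  finally show ?thesis .
qed

section \<open>Series of inverse prime powers and the condition at one prime\<close>

lemma summable_inverse_prime_power:
  "prime (p::nat) \<Longrightarrow> summable (\<lambda>m. 1 / real p ^ m)"
  using summable_geometric[of "1 / real p"] prime_gt_1_nat[of p]
  by (simp add: power_one_over)

lemma summable_on_inverse_prime_power:
  "prime (p::nat) \<Longrightarrow> (\<lambda>m. 1 / real p ^ m) summable_on A"
  by (rule summable_on_subset_banach[of _ UNIV])
     (simp_all add: summable_on_UNIV_nonneg_real_iff summable_inverse_prime_power)

text \<open>Turns the unordered sum into an ordinary series, the form to which Tannery's theorem and
  the geometric series apply.\<close>

lemma infsum_inverse_prime_power:
  assumes "prime (p::nat)"
  shows "(\<Sum>\<^sub>\<infinity>m\<in>A. 1 / real p ^ m) = (\<Sum>m. if m \<in> A then 1 / real p ^ m else 0)"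
proof -
  have "((\<lambda>m. 1 / real p ^ m) has_sum (\<Sum>\<^sub>\<infinity>m\<in>A. 1 / real p ^ m)) A"
    using summable_on_inverse_prime_power[OF assms] by (rule has_sum_infsum)
  then have "((\<lambda>m. if m \<in> A then 1 / real p ^ m else 0) has_sum (\<Sum>\<^sub>\<infinity>m\<in>A. 1 / real p ^ m)) UNIV"
    by (rule has_sum_cong_neutral[THEN iffD1, rotated -1]) auto
  from has_sum_imp_sums[OF this] show ?thesis by (simp add: sums_iff)
qed

text \<open>
  The elements of \<open>B\<close> of \<open>p\<close>-adic valuation \<open>m\<close> are \<open>p\<^sup>m\<close> times the elements of \<open>B\<close> that are
  prime to \<open>p\<close>; summing their frequencies over \<open>m\<close> is an instance of dominated convergence.
\<close>
lemma has_natural_density_multiplicity: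
  fixes B :: "nat set"
  assumes inv: "\<And>n. n > 0 \<Longrightarrow> p * n \<in> B \<longleftrightarrow> n \<in> B" and p: "prime p"
    and d: "has_natural_density B d"
  shows "has_natural_density {n \<in> B. multiplicity p n \<in> A}
    (d * ((1 - 1 / real p) * (\<Sum>\<^sub>\<infinity>m\<in>A. 1 / real p ^ m)))"
proof -
  let ?C = "\<lambda>N m. {n \<in> B \<inter> {1..N}. multiplicity p n = m}"
  \<comment> \<open>Terms outside \<open>A\<close> are set to \<open>0\<close> so that the series
    run over all \<open>m\<close>; \<open>b m\<close> is the limit of \<open>a m N\<close> as
    \<open>N\<close> grows.\<close>
  define a where "a m N = (if m \<in> A then real (card (?C N m)) / real N else 0)" for m N
  define b where "b m = (if m \<in> A then d / real p ^ m - d / real p ^ Suc m else 0)" for m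
  have "p > 1" using p by (rule prime_gt_1_nat)
  have count_eq: "real (card (?C N m)) =
      real (card (B \<inter> {1..N div p ^ m})) - real (card (B \<inter> {1..N div p ^ Suc m}))" for N m
    by (rule card_multiplicity_eq[OF inv p])
  have "(\<lambda>N. a m N) \<longlonglongrightarrow> b m" for m
  proof (cases "m \<in> A")
    case True
    then show ?thesis
      using tendsto_diff[OF has_natural_density_div[OF d, of "p ^ m"]
          has_natural_density_div[OF d, of "p ^ Suc m"]] \<open>p > 1\<close>
      by (simp add: a_def b_def count_eq diff_divide_distrib del: power_Suc One_nat_def Int_iff)
  qed (simp add: a_def b_def)
  moreover have "norm (a m N) \<le> 1 / real p ^ m" for m N
  proof -
    have "real (card (?C N m)) \<le> real (N div p ^ m)"
      using card_multiplicity_le[OF p] by (simp only: of_nat_le_iff)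
    also have "\<dots> \<le> real N / real (p ^ m)" by (rule of_nat_div_le_of_nat)
    finally have "real (card (?C N m)) / real N \<le> real N / real (p ^ m) / real N"
      by (intro divide_right_mono) auto
    also have "\<dots> \<le> 1 / real p ^ m" by simp
    finally show ?thesis by (simp add: a_def)
  qed
  ultimately have "(\<lambda>N. \<Sum>m. a m N) \<longlonglongrightarrow> (\<Sum>m. b m)"
    using summable_inverse_prime_power[OF p]
    by (intro tannerys_theorem[where M = "\<lambda>m. 1 / real p ^ m", THEN conjunct2, THEN conjunct2])
       (auto intro!: always_eventually)
  moreover have "(\<Sum>m. a m N) = real (card ({n \<in> B. multiplicity p n \<in> A} \<inter> {1..N})) / real N" for N
  proof -
    \<comment> \<open>Only finitely many valuations occur in \<open>{1..N}\<close>, so for each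
      \<open>N\<close> the series is a finite sum.\<close>
    let ?F = "multiplicity p ` {1..N} \<inter> A"
    have "(\<Sum>m. a m N) = (\<Sum>m\<in>?F. a m N)"
      by (rule suminf_finite) (auto simp: a_def intro!: arg_cong[where f = card, of _ "{}", simplified])
    also have "\<dots> = real (\<Sum>m\<in>?F. card (?C N m)) / real N"
      by (simp add: a_def sum_divide_distrib)
    also have "(\<Sum>m\<in>?F. card (?C N m)) = card (\<Union>m\<in>?F. ?C N m)"
      by (rule card_UN_disjoint[symmetric]) auto
    also have "(\<Union>m\<in>?F. ?C N m) = {n \<in> B. multiplicity p n \<in> A} \<inter> {1..N}" by auto
    finally show ?thesis .
  qed
  moreover have "(\<Sum>m. b m) = d * ((1 - 1 / real p) * (\<Sum>\<^sub>\<infinity>m\<in>A. 1 / real p ^ m))"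
  proof -
    have "summable (\<lambda>m. if m \<in> A then 1 / real p ^ m else 0)"
      by (rule summable_comparison_test'[OF summable_inverse_prime_power[OF p], of 0]) auto
    then have "(\<Sum>m. d * (1 - 1 / real p) * (if m \<in> A then 1 / real p ^ m else 0)) =
        d * (1 - 1 / real p) * (\<Sum>\<^sub>\<infinity>m\<in>A. 1 / real p ^ m)"
      unfolding infsum_inverse_prime_power[OF p] by (rule suminf_mult)
    moreover have "b m = d * (1 - 1 / real p) * (if m \<in> A then 1 / real p ^ m else 0)" for m
      using \<open>p > 1\<close> by (simp add: b_def field_simps)
    ultimately show ?thesis by (simp add: mult.assoc)
  qed
  ultimately show ?thesis by (simp add: has_natural_density_def)
qed

section \<open>Euler factors and the conditions at finitely many primes\<close>

text \<open>For prime \<open>p\<close> this is the density of the numbers whose p-adic valuation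
  lies in \<open>A p\<close>. The value \<open>1\<close> at non-primes lets products run over all
  naturals.\<close>

definition euler_factor :: "(nat \<Rightarrow> nat set) \<Rightarrow> nat \<Rightarrow> real" where
  "euler_factor A p =
     (if prime p then (1 - 1 / real p) * (\<Sum>\<^sub>\<infinity>m\<in>A p. 1 / real p ^ m) else 1)"

lemma has_natural_density_multiplicity_below:
  "has_natural_density {n. \<forall>p<k. prime p \<longrightarrow> multiplicity p n \<in> A p} (\<Prod>p<k. euler_factor A p)"
proof (induction k)
  case 0
  then show ?case using has_natural_density_UNIV by simp
next
  case (Suc k)
  let ?B = "\<lambda>k. {n. \<forall>p<k. prime p \<longrightarrow> multiplicity p n \<in> A p}"
  show ?case
  proof (cases "prime k")
    case True
    \<comment> \<open>Multiplication by the prime \<open>k\<close> preserves valuations at smaller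
      primes, so \<open>?B k\<close> is invariant under it, as
      \<open>has_natural_density_multiplicity\<close> requires.\<close>
    have "multiplicity p (k * n) = multiplicity p n" if "n > 0" "p < k" "prime p" for p n
      using that True primes_dvd_imp_eq[of p k] prime_gt_0_nat[of k]
      by (auto simp: prime_elem_multiplicity_mult_distrib intro: not_dvd_imp_multiplicity_0)
    then have "has_natural_density {n \<in> ?B k. multiplicity k n \<in> A k}
        ((\<Prod>p<k. euler_factor A p) * ((1 - 1 / real k) * (\<Sum>\<^sub>\<infinity>m\<in>A k. 1 / real k ^ m)))"
      by (intro has_natural_density_multiplicity Suc.IH True) auto
    moreover have "{n \<in> ?B k. multiplicity k n \<in> A k} = ?B (Suc k)"
      using True by (auto simp: less_Suc_eq)
    ultimately show ?thesis using True by (simp add: euler_factor_def)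
  next
    case False
    then have "?B (Suc k) = ?B k" by (auto simp: less_Suc_eq)
    then show ?thesis using Suc.IH False by (simp add: euler_factor_def)
  qed
qed

section \<open>Frequency of multiples of large squares\<close>

lemma sum_inverse_squares_le:
  assumes "(k::nat) \<ge> 2"
  shows "(\<Sum>p = k..N. 1 / real p ^ 2) \<le> 1 / (real k - 1)"
proof -
  \<comment> \<open>The term \<open>- 1 / real N\<close> strengthens the claim for the induction:
    each new summand is at most the telescoping difference \<open>1 / N - 1 / Suc N\<close>.\<close>
  have "(\<Sum>p = k..N. 1 / real p ^ 2) \<le> 1 / (real k - 1) - 1 / real N" if "N \<ge> k"
    using that
  proof (induction N rule: dec_induct)
    case base
    then show ?case using assms by (simp add: field_simps power2_eq_square)
  next
    case (step N)
    have "N > 0" using step assms by simp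
    then have "1 / real (Suc N) ^ 2 \<le> 1 / (real N * real (Suc N))"
      unfolding power2_eq_square by (intro divide_left_mono mult_right_mono) auto
    also have "\<dots> = 1 / real N - 1 / real (Suc N)"
      using \<open>N > 0\<close> by (simp add: field_simps)
    finally have "1 / real (Suc N) ^ 2 \<le> 1 / real N - 1 / real (Suc N)" .
    then show ?case using step by simp
  qed
  moreover have "1 / (real k - 1) - 1 / real N \<le> 1 / (real k - 1)" by simp
  ultimately show ?thesis
    using assms by (cases "N \<ge> k") (auto intro: order_trans simp del: diff_le_eq)
qed

text \<open>A union bound: for each \<open>p\<close> there are \<open>N div p ^ 2\<close> multiples
  of \<open>p ^ 2\<close> up to \<open>N\<close>.\<close>

lemma card_square_multiples_le:
  assumes "(k::nat) \<ge> 2"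
  shows "real (card {n \<in> {1..N}. \<exists>p\<ge>k. p ^ 2 dvd n}) \<le> real N / (real k - 1)"
proof -
  have "{n \<in> {1..N}. \<exists>p\<ge>k. p ^ 2 dvd n} \<subseteq> (\<Union>p\<in>{k..N}. {n \<in> UNIV \<inter> {1..N}. p ^ 2 dvd n})"
  proof
    fix n assume "n \<in> {n \<in> {1..N}. \<exists>p\<ge>k. p ^ 2 dvd n}"
    then obtain p where p: "p \<ge> k" "p ^ 2 dvd n" "1 \<le> n" "n \<le> N" by auto
    \<comment> \<open>From \<open>p \<le> p ^ 2 \<le> n \<le> N\<close> only the finitely many
      \<open>p\<close> in \<open>{k..N}\<close> can occur.\<close>
    then have "p ^ 2 \<le> n" by (intro dvd_imp_le) auto
    moreover have "p \<le> p ^ 2" by (simp add: power2_nat_le_imp_le power2_eq_square)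
    ultimately show "n \<in> (\<Union>p\<in>{k..N}. {n \<in> UNIV \<inter> {1..N}. p ^ 2 dvd n})" using p by auto
  qed
  then have "card {n \<in> {1..N}. \<exists>p\<ge>k. p ^ 2 dvd n} \<le>
      card (\<Union>p\<in>{k..N}. {n \<in> UNIV \<inter> {1..N}. p ^ 2 dvd n})"
    by (rule card_mono[rotated]) auto
  also have "\<dots> \<le> (\<Sum>p = k..N. card {n \<in> UNIV \<inter> {1..N}. p ^ 2 dvd n})"
    by (rule card_UN_le) simp
  also have "\<dots> = (\<Sum>p = k..N. N div p ^ 2)"
    by (rule sum.cong) (use assms card_multiples_power[of _ UNIV N 2] in auto)
  finally have "real (card {n \<in> {1..N}. \<exists>p\<ge>k. p ^ 2 dvd n}) \<le> (\<Sum>p = k..N. real (N div p ^ 2))"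
    by (simp only: of_nat_le_iff flip: of_nat_sum)
  also have "\<dots> \<le> (\<Sum>p = k..N. real N * (1 / real p ^ 2))"
  proof (rule sum_mono)
    fix p
    show "real (N div p ^ 2) \<le> real N * (1 / real p ^ 2)"
      using of_nat_div_le_of_nat[where 'a = real, of N "p ^ 2"] by (simp del: of_nat_div)
  qed
  also have "\<dots> \<le> real N * (1 / (real k - 1))"
    unfolding sum_distrib_left[symmetric]
    by (intro mult_left_mono sum_inverse_squares_le assms) simp
  finally show ?thesis by simp
qed

section \<open>Complementary exponent sets and convergence of the Euler product\<close>

text \<open>The sums over \<open>A\<close> and \<open>- A\<close> add up to the full geometric
  series, whose value is \<open>1 / (1 - 1 / p)\<close>.\<close>

lemma euler_sum_Compl:
  assumes p: "prime (p::nat)"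
  shows "(1 - 1 / real p) * (\<Sum>\<^sub>\<infinity>m\<in>- A. 1 / real p ^ m) =
    1 - (1 - 1 / real p) * (\<Sum>\<^sub>\<infinity>m\<in>A. 1 / real p ^ m)"
proof -
  have "p > 1" using p by (rule prime_gt_1_nat)
  have "(\<Sum>\<^sub>\<infinity>m\<in>A. 1 / real p ^ m) + (\<Sum>\<^sub>\<infinity>m\<in>- A. 1 / real p ^ m) = (\<Sum>\<^sub>\<infinity>m\<in>A \<union> - A. 1 / real p ^ m)"
    by (intro infsum_Un_disjoint[symmetric] summable_on_inverse_prime_power p) auto
  also have "\<dots> = (\<Sum>m. 1 / real p ^ m)"
    by (simp add: infsum_inverse_prime_power[OF p])
  also have "\<dots> = 1 / (1 - 1 / real p)"
    using suminf_geometric[of "1 / real p"] \<open>p > 1\<close> by (simp add: power_one_over)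
  finally show ?thesis
    using \<open>p > 1\<close> by (simp add: field_simps)
qed

text \<open>By complementation the deviation from \<open>1\<close> is the weighted sum over the
  forbidden exponents. These are all at least \<open>2\<close>, so the extreme case forbids exactly
  those.\<close>

lemma norm_euler_factor_minus_1_le:
  assumes "{0, 1} \<subseteq> A p"
  shows "norm (euler_factor A p - 1) \<le> 1 / real p ^ 2"
proof (cases "prime p")
  case p: True
  have "p > 1" using p by (rule prime_gt_1_nat)
  let ?s = "\<Sum>\<^sub>\<infinity>m\<in>- A p. 1 / real p ^ m"
  have "0 \<le> ?s" by (rule infsum_nonneg) simp
  have "?s \<le> (\<Sum>\<^sub>\<infinity>m\<in>- {0, 1}. 1 / real p ^ m)"
    by (rule infsum_mono_neutral) (use assms p in \<open>auto intro: summable_on_inverse_prime_power\<close>)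
  then have "(1 - 1 / real p) * ?s \<le> (1 - 1 / real p) * (\<Sum>\<^sub>\<infinity>m\<in>- {0, 1}. 1 / real p ^ m)"
    using \<open>p > 1\<close> by (intro mult_left_mono) auto
  \<comment> \<open>Complementing again leaves \<open>1 - (1 - 1 / p) * (1 + 1 / p)\<close>.\<close>
  also have "\<dots> = 1 / real p ^ 2"
    unfolding euler_sum_Compl[OF p] using \<open>p > 1\<close> by (simp add: field_simps power2_eq_square)
  finally have "(1 - 1 / real p) * ?s \<le> 1 / real p ^ 2" .
  moreover have "0 \<le> (1 - 1 / real p) * ?s" using \<open>0 \<le> ?s\<close> \<open>p > 1\<close> by simp
  ultimately show ?thesis
    using p euler_sum_Compl[OF p, of "- A p"] by (simp add: euler_factor_def)
qed (simp add: euler_factor_def)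

text \<open>Comparison with the sum of inverse squares. Requiring the exponents \<open>0\<close> and
  \<open>1\<close> only beyond \<open>K\<close> leaves room for the exceptional prime
  \<open>q\<close>, where only \<open>0\<close> is allowed.\<close>

lemma convergent_prod_euler_factor:
  assumes "\<And>p. p > K \<Longrightarrow> {0, 1} \<subseteq> A p"
  shows "convergent_prod (euler_factor A)"
proof -
  have "summable (\<lambda>p. 1 / real p ^ 2)"
    using inverse_power_summable[of 2, where 'a = real] by (simp add: field_simps)
  then have "summable (\<lambda>p. norm (euler_factor A p - 1))"
    by (rule summable_comparison_test'[of _ "Suc K"]) (use norm_euler_factor_minus_1_le assms in auto)
  then show ?thesis
    by (intro abs_convergent_prod_imp_convergent_prod summable_imp_abs_convergent_prod)
qed

section \<open>Conditions at all primes: interchange of limits\<close>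

lemma has_natural_density_multiplicity_all:
  assumes A: "\<And>p. p > K \<Longrightarrow> {0, 1} \<subseteq> A p"
  shows "has_natural_density {n. \<forall>p. prime p \<longrightarrow> multiplicity p n \<in> A p} (\<Prod>p. euler_factor A p)"
proof -
  define B where "B k = {n. \<forall>p<k. prime p \<longrightarrow> multiplicity p n \<in> A p}" for k
  define C where "C = {n. \<forall>p. prime p \<longrightarrow> multiplicity p n \<in> A p}"
  define R where "R X N = real (card (X \<inter> {1..N})) / real N" for X :: "nat set" and N
  \<comment> \<open>The bound does not depend on \<open>N\<close>, which yields the uniform
    convergence below.\<close>
  have close: "norm (R (B k) N - R C N) \<le> 1 / (real k - 1)" if k: "k > K" "k \<ge> 2" for k N
  proof -
    have sub: "C \<inter> {1..N} \<subseteq> B k \<inter> {1..N}" by (auto simp: B_def C_def)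
    have "B k \<inter> {1..N} - C \<inter> {1..N} \<subseteq> {n \<in> {1..N}. \<exists>p\<ge>k. p ^ 2 dvd n}"
    proof
      fix n assume n: "n \<in> B k \<inter> {1..N} - C \<inter> {1..N}"
      then obtain p where p: "prime p" "multiplicity p n \<notin> A p" by (auto simp: C_def)
      with n have "p \<ge> k" by (force simp: B_def)
      \<comment> \<open>As \<open>p \<ge> k > K\<close>, the exponents \<open>0\<close> and
        \<open>1\<close> are allowed, so a violated condition forces valuation at least
        \<open>2\<close>.\<close>
      with A[of p] k p have "multiplicity p n \<noteq> 0" "multiplicity p n \<noteq> 1"
        by (metis insert_subset less_le_trans)+
      then have "p ^ 2 dvd n" by (intro multiplicity_dvd') simp
      with n \<open>p \<ge> k\<close> show "n \<in> {n \<in> {1..N}. \<exists>p\<ge>k. p ^ 2 dvd n}" by auto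
    qed
    then have "card (B k \<inter> {1..N} - C \<inter> {1..N}) \<le> card {n \<in> {1..N}. \<exists>p\<ge>k. p ^ 2 dvd n}"
      by (rule card_mono[rotated]) auto
    then have "real (card (B k \<inter> {1..N})) - real (card (C \<inter> {1..N})) \<le> real N / (real k - 1)"
      using card_square_multiples_le[OF k(2), of N] sub card_mono[OF _ sub]
      by (simp add: card_Diff_subset)
    then have "R (B k) N - R C N \<le> real N / (real k - 1) / real N"
      unfolding R_def diff_divide_distrib[symmetric] by (intro divide_right_mono) auto
    also have "\<dots> \<le> 1 / (real k - 1)" using k by simp
    finally have "R (B k) N - R C N \<le> 1 / (real k - 1)" .
    moreover have "R C N \<le> R (B k) N"
      unfolding R_def using card_mono[OF _ sub] by (intro divide_right_mono) auto
    ultimately show ?thesis by simp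
  qed
  have "(R C \<longlongrightarrow> (\<Prod>p. euler_factor A p)) sequentially"
  \<comment> \<open>For fixed \<open>k\<close> the ratios converge in \<open>N\<close>, and as
    \<open>k\<close> grows they approach \<open>R C\<close> uniformly in \<open>N\<close>; hence the
    limit of the partial products is the limit of \<open>R C\<close>.\<close>
  proof (rule swap_uniform_limit'[where F = sequentially and S = UNIV])
    show "\<forall>\<^sub>F k in sequentially. (R (B k) \<longlongrightarrow> (\<Prod>p<k. euler_factor A p)) sequentially"
      using has_natural_density_multiplicity_below[of _ A]
      by (auto simp: has_natural_density_def R_def[abs_def] B_def intro!: always_eventually)
    show "(\<lambda>k. \<Prod>p<k. euler_factor A p) \<longlonglongrightarrow> (\<Prod>p. euler_factor A p)"
      unfolding LIMSEQ_lessThan_iff_atMost[where f = "prod (euler_factor A)"]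
      by (rule convergent_prod_LIMSEQ, rule convergent_prod_euler_factor, rule A)
    show "uniform_limit UNIV (\<lambda>k. R (B k)) (R C) sequentially"
    proof (rule uniform_limitI)
      fix e :: real assume "e > 0"
      have "(\<lambda>k. 1 / (real k - 1)) \<longlonglongrightarrow> 0" by real_asymp
      then have "\<forall>\<^sub>F k in sequentially. 1 / (real k - 1) < e"
        using \<open>e > 0\<close> by (rule order_tendstoD)
      then show "\<forall>\<^sub>F k in sequentially. \<forall>N\<in>UNIV. dist (R (B k) N) (R C N) < e"
        using eventually_gt_at_top[of K] eventually_ge_at_top[of 2]
      proof eventually_elim
        case (elim k)
        show ?case
          using le_less_trans[OF close[OF elim(2,3)] elim(1)] by (simp add: dist_norm)
      qed
    qed
  qed auto
  then show ?thesis by (simp add: has_natural_density_def R_def[abs_def] C_def)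
qed

section \<open>Application to tower factorizations\<close>

text \<open>One level of the recursion: \<open>q\<close> occurs in the tower of \<open>n\<close> iff
  it divides \<open>n\<close> or occurs in the tower of some exponent. The set \<open>{0}\<close> at
  \<open>q\<close> encodes non-divisibility.\<close>

lemma notin_tower_M_iff:
  assumes "n > 0"
  shows "n \<notin> tower_M q \<longleftrightarrow>
    (\<forall>p. prime p \<longrightarrow> multiplicity p n \<in> (if p = q then {0} else tower_Mc q))"
proof -
  have "n \<notin> tower_M q \<longleftrightarrow> (\<forall>p\<in>prime_factors n. p \<noteq> q \<and> multiplicity p n \<in> tower_Mc q)"
    using assms unfolding tower_M_def tower_Mc_def
    by (subst tower_primes_tower_factorization)
       (auto simp: prime_factors_multiplicity)
  \<comment> \<open>Primes not dividing \<open>n\<close> have exponent \<open>0\<close>, which is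
    allowed everywhere, so the condition may be stated for all primes.\<close>
  also have "\<dots> \<longleftrightarrow> (\<forall>p. prime p \<longrightarrow> multiplicity p n \<in> (if p = q then {0} else tower_Mc q))"
    using zero_one_notin_tower_M(1)[of q]
    by (auto simp: prime_factors_multiplicity tower_Mc_def) (metis gr0I)
  finally show ?thesis .
qed

text \<open>Restores the factor at \<open>q\<close> by multiplying with the product whose only
  nontrivial factor is \<open>f q\<close>. It serves both the density product and the last formula
  of the theorem.\<close>

lemma prodinf_split_factor:
  fixes f :: "nat \<Rightarrow> real" and q :: nat
  assumes "convergent_prod (\<lambda>p. if p = q then 1 else f p)"
  shows "convergent_prod f" "prodinf f = f q * (\<Prod>p. if p = q then 1 else f p)"
proof -
  have single: "(\<lambda>p. if p = q then f p else 1) has_prod f q" by (rule has_prod_single)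
  have "f has_prod (f q * (\<Prod>p. if p = q then 1 else f p))"
    using has_prod_mult[OF single convergent_prod_has_prod[OF assms]]
    by (rule back_subst[of "\<lambda>g. g has_prod _"]) auto
  then show "convergent_prod f" "prodinf f = f q * (\<Prod>p. if p = q then 1 else f p)"
    by (auto simp: has_prod_iff)
qed

theorem theorem1:
  fixes q :: nat
  assumes "prime q"
  shows "convergent (tower_M_ratio q) \<and>
    convergent_prod (\<lambda>p::nat. if prime p \<and> p \<noteq> q
           then 1 - (1 - 1 / real p) * (\<Sum>\<^sub>\<infinity>m\<in>tower_M q. 1 / real p ^ m) else 1) \<and>
    (tower_density q = 1 - (1 - 1 / real q) *
           (\<Prod>p::nat. if prime p \<and> p \<noteq> q
              then 1 - (1 - 1 / real p) * (\<Sum>\<^sub>\<infinity>m\<in>tower_M q. 1 / real p ^ m) else 1)) \<and>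
    convergent_prod (\<lambda>p::nat. if prime p \<and> p \<noteq> q
           then (1 - 1 / real p) * (\<Sum>\<^sub>\<infinity>m\<in>tower_Mc q. 1 / real p ^ m) else 1) \<and>
    (tower_density q = 1 - (1 - 1 / real q) *
           (\<Prod>p::nat. if prime p \<and> p \<noteq> q
              then (1 - 1 / real p) * (\<Sum>\<^sub>\<infinity>m\<in>tower_Mc q. 1 / real p ^ m) else 1)) \<and>
    convergent_prod (\<lambda>p::nat. if prime p
           then (1 - 1 / real p) * (\<Sum>\<^sub>\<infinity>m\<in>tower_Mc q. 1 / real p ^ m) else 1) \<and>
    (tower_density q = 1 - inverse (\<Sum>\<^sub>\<infinity>m\<in>tower_Mc q. 1 / real q ^ m) *
           (\<Prod>p::nat. if prime p
              then (1 - 1 / real p) * (\<Sum>\<^sub>\<infinity>m\<in>tower_Mc q. 1 / real p ^ m) else 1))"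
proof -
  let ?M = "\<lambda>p::nat. if prime p \<and> p \<noteq> q
           then 1 - (1 - 1 / real p) * (\<Sum>\<^sub>\<infinity>m\<in>tower_M q. 1 / real p ^ m) else 1"
  let ?Mc = "\<lambda>p::nat. if prime p \<and> p \<noteq> q
           then (1 - 1 / real p) * (\<Sum>\<^sub>\<infinity>m\<in>tower_Mc q. 1 / real p ^ m) else 1"
  define S where "S p = (\<Sum>\<^sub>\<infinity>m\<in>tower_Mc q. 1 / real p ^ m)" for p :: nat
  let ?all = "\<lambda>p::nat. if prime p then (1 - 1 / real p) * S p else 1"
  define A where "A p = (if p = q then {0} else tower_Mc q)" for p
  define P where "P = prodinf ?Mc"
  have "q > 1" using assms by (rule prime_gt_1_nat)
  \<comment> \<open>\<open>tower_Mc q\<close> is the complement of \<open>tower_M q\<close>, so the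
    first two products agree factor by factor.\<close>
  have M_eq: "?M = ?Mc"
    using euler_sum_Compl[of _ "tower_M q"]
    by (auto simp: fun_eq_iff tower_Mc_def Compl_eq)
  have A01: "{0, 1} \<subseteq> A p" if "p > q" for p
    using zero_one_notin_tower_M[of q] that by (auto simp: A_def tower_Mc_def)
  have Mc_eq: "?Mc = (\<lambda>p. if p = q then 1 else euler_factor A p)"
    by (auto simp: fun_eq_iff euler_factor_def A_def)
  have Aq: "euler_factor A q = 1 - 1 / real q"
    using assms by (simp add: euler_factor_def A_def)
  have conv: "convergent_prod ?Mc"
  proof -
    \<comment> \<open>Allowing every exponent at \<open>q\<close> makes the Euler factor there equal
      to \<open>1\<close>.\<close>
    have "?Mc = euler_factor (A(q := UNIV))"
      using euler_sum_Compl[OF assms, of "{}"]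
      by (auto simp: fun_eq_iff euler_factor_def A_def)
    then show ?thesis
      using convergent_prod_euler_factor[of q "A(q := UNIV)"] A01 by simp
  qed
  have "prodinf (euler_factor A) = (1 - 1 / real q) * P"
    using prodinf_split_factor(2)[of q "euler_factor A"] conv
    unfolding P_def Mc_eq Aq by simp
  then have dens: "has_natural_density {n. \<forall>p. prime p \<longrightarrow> multiplicity p n \<in> A p} ((1 - 1 / real q) * P)"
    using has_natural_density_multiplicity_all[of q A] A01 by simp
  \<comment> \<open>At \<open>N = 0\<close> the left side would be \<open>0\<close> and the right
    side \<open>1\<close>.\<close>
  have ratio: "tower_M_ratio q N =
      1 - real (card ({n. \<forall>p. prime p \<longrightarrow> multiplicity p n \<in> A p} \<inter> {1..N})) / real N"
    if "N > 0" for N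
  proof -
    have eq: "{n. \<forall>p. prime p \<longrightarrow> multiplicity p n \<in> A p} \<inter> {1..N} = {1..N} - (tower_M q \<inter> {1..N})"
    proof (rule set_eqI)
      fix n
      show "n \<in> {n. \<forall>p. prime p \<longrightarrow> multiplicity p n \<in> A p} \<inter> {1..N} \<longleftrightarrow>
          n \<in> {1..N} - (tower_M q \<inter> {1..N})"
        using notin_tower_M_iff[of n q] unfolding A_def by (cases "n > 0") auto
    qed
    have "card (tower_M q \<inter> {1..N}) \<le> card {1..N}" by (intro card_mono) auto
    then show ?thesis
      using that unfolding eq tower_M_ratio_def
      by (subst card_Diff_subset) (auto simp: of_nat_diff field_simps)
  qed
  have lim: "tower_M_ratio q \<longlonglongrightarrow> 1 - (1 - 1 / real q) * P"
  proof (rule Lim_transform_eventually)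
    show "(\<lambda>N. 1 - real (card ({n. \<forall>p. prime p \<longrightarrow> multiplicity p n \<in> A p} \<inter> {1..N})) / real N)
        \<longlonglongrightarrow> 1 - (1 - 1 / real q) * P"
      using dens unfolding has_natural_density_def by (intro tendsto_intros)
    show "\<forall>\<^sub>F N in sequentially. 1 - real (card ({n. \<forall>p. prime p \<longrightarrow> multiplicity p n \<in> A p} \<inter> {1..N})) / real N
        = tower_M_ratio q N"
      using eventually_gt_at_top[of 0] by eventually_elim (simp add: ratio)
  qed
  have density: "tower_density q = 1 - (1 - 1 / real q) * P"
    unfolding tower_density_def using lim by (rule limI)
  have Mc_all: "?Mc = (\<lambda>p. if p = q then 1 else ?all p)"
    by (auto simp: fun_eq_iff S_def)
  \<comment> \<open>The full product has the factor \<open>(1 - 1 / q) * S q\<close> at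
    \<open>q\<close>, so dividing by \<open>S q\<close> leaves the factor \<open>1 - 1 / q\<close>
    of the density formula.\<close>
  have all: "convergent_prod ?all" "prodinf ?all = (1 - 1 / real q) * S q * P"
    using prodinf_split_factor[of q ?all, folded Mc_all, OF conv, folded P_def] assms by simp_all
  \<comment> \<open>The exponent \<open>0\<close> alone contributes \<open>1\<close>, so
    \<open>S q\<close> is nonzero and its inverse cancels.\<close>
  have "(\<Sum>\<^sub>\<infinity>m\<in>{0}. 1 / real q ^ m) \<le> S q"
    unfolding S_def using zero_one_notin_tower_M(1)[of q] assms
    by (intro infsum_mono_neutral) (auto simp: tower_Mc_def intro: summable_on_inverse_prime_power)
  then have "S q > 0" by simp
  then have "inverse (S q) * prodinf ?all = (1 - 1 / real q) * P"
    unfolding all(2) by (simp add: field_simps)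
  then have "tower_density q = 1 - inverse (S q) * prodinf ?all"
    using density by simp
  moreover have "convergent (tower_M_ratio q)"
    using lim by (rule convergentI)
  ultimately show ?thesis
    unfolding M_eq using conv all(1) density by (intro conjI) (simp_all only: P_def S_def)
qed

end
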